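(* Let $k_1,k_2,T_c>0$ and $\rho_L\le\rho_U$ be real numbers, and consider the sampled closed loop described in the context on an interval on which the actuator is unsaturated and $a,d$ are constant, so that $\xi_k=[e_k,w_k,w_{k-1}]^T$ obeys $$\xi_{k+1}=A_d(\rho_k)\,\xi_k,\qquad A_d(\rho)=\begin{bmatrix}1&-T_c&0\\ T_ck_1k_2\rho&1-T_ck_2&T_ck_2(1-\rho)\\ 0&1&0\end{bmatrix}.$$ Suppose $\rho_k\in[\rho_L,\rho_U]$ for all $k$. If there are symmetric positive definite matrices $P\succ0$, $Q\succ0$ in $\mathbb{R}^{3\times 3}$ such that $$A_d(\rho_i)^TPA_d(\rho_i)-P\preceq -Q\qquad\text{for both } \rho_i\in\{\rho_L,\rho_U\},$$ then the origin of $\xi_{k+1}=A_d(\rho_k)\xi_k$ is uniformly exponentially stable for every time-varying sequence $(\rho_k)$ with values in $[\rho_L,\rho_U]$.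
   Context: Here $\preceq$ and $\succ$ refer to the Loewner order on real symmetric matrices. Uniform exponential stability of the origin of $\xi_{k+1}=A_d(\rho_k)\xi_k$ means: there are constants $C\ge 1$ and $\mu\in(0,1)$, independent of the initial time $k_0$ and the initial state $\xi_{k_0}$, such that $\|\xi_k\|_2\le C\mu^{k-k_0}\|\xi_{k_0}\|_2$ for all $k\ge k_0$. Origin of the recursion. The plant is sampled with period $T_c$ as $x_{1,k}=x_{1,k-1}+T_c(a x_{2,k-1}+d)$, $x_{2,k}=x_{2,k-1}+T_cu_{k-1}$, with $a>0$ and $d$ constant on the analyzed interval. The reference $r$ is constant, $e_k=r-x_{1,k}$, and $\delta x_{1,k}=(x_{1,k}-x_{1,k-1})/T_c$. The unsaturated control law is $u_k=k_2[\hat\alpha_k(k_1e_k-\delta x_{1,k})+x_{2,k-1}-x_{2,k}]$, where $\hat\alpha_k$ is an estimate of $1/a$. One sets $w_k=ax_{2,k}+d$ and $\rho_k=a\hat\alpha_k$. *)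

theory Defs
  imports "HOL-Analysis.Analysis"
begin

definition positive_semidefinite :: "real^'n^'n \<Rightarrow> bool" where
  "positive_semidefinite M \<longleftrightarrow> transpose M = M \<and> (\<forall>x. 0 \<le> x \<bullet> (M *v x))"

definition positive_definite :: "real^'n^'n \<Rightarrow> bool" where
  "positive_definite M \<longleftrightarrow> transpose M = M \<and> (\<forall>x. x \<noteq> 0 \<longrightarrow> 0 < x \<bullet> (M *v x))"

definition loewner_le :: "real^'n^'n \<Rightarrow> real^'n^'n \<Rightarrow> bool" (infix "\<preceq>" 50) where
  "M \<preceq> N \<longleftrightarrow> positive_semidefinite (N - M)"

definition loewner_less :: "real^'n^'n \<Rightarrow> real^'n^'n \<Rightarrow> bool" (infix "\<prec>" 50) where
  "M \<prec> N \<longleftrightarrow> positive_definite (N - M)"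

text \<open>
  Stability of the origin of \<open>\<xi> (k + 1) = f k (\<xi> k)\<close>. The constants \<open>C\<close> and \<open>\<mu>\<close> may
  depend on \<open>f\<close>, but not on the initial time or the initial state.
\<close>

definition uniformly_exponentially_stable ::
    "(nat \<Rightarrow> 'a::real_normed_vector \<Rightarrow> 'a) \<Rightarrow> bool" where
  "uniformly_exponentially_stable f \<longleftrightarrow>
     (\<exists>C \<mu>. 1 \<le> C \<and> 0 < \<mu> \<and> \<mu> < 1 \<and>
        (\<forall>k\<^sub>0 \<xi>. (\<forall>k\<ge>k\<^sub>0. \<xi> (Suc k) = f k (\<xi> k)) \<longrightarrow>
           (\<forall>k\<ge>k\<^sub>0. norm (\<xi> k) \<le> C * \<mu> ^ (k - k\<^sub>0) * norm (\<xi> k\<^sub>0))))"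

definition A_d :: "real \<Rightarrow> real \<Rightarrow> real \<Rightarrow> real \<Rightarrow> real^3^3" where
  "A_d k\<^sub>1 k\<^sub>2 T\<^sub>c \<rho> = vector
     [vector [1, - T\<^sub>c, 0],
      vector [T\<^sub>c * k\<^sub>1 * k\<^sub>2 * \<rho>, 1 - T\<^sub>c * k\<^sub>2, T\<^sub>c * k\<^sub>2 * (1 - \<rho>)],
      vector [0, 1, 0]]"

definition tracking_error :: "real \<Rightarrow> (nat \<Rightarrow> real) \<Rightarrow> nat \<Rightarrow> real" where
  "tracking_error r x\<^sub>1 k = r - x\<^sub>1 k"

text \<open>
  \<open>closed_loop\<close> describes the plant under the unsaturated control law on the sampling instants
  \<open>m, \<dots>, n\<close>, where \<open>\<alpha> k\<close> is the estimate of \<open>1 / a\<close>. Both laws refer to the instant \<open>k - 1\<close>,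
  so they are imposed for \<open>m < k\<close>; in particular \<open>k - 1\<close> is never truncated.
\<close>

definition closed_loop ::
    "real \<Rightarrow> real \<Rightarrow> real \<Rightarrow> real \<Rightarrow> real \<Rightarrow> real \<Rightarrow> (nat \<Rightarrow> real) \<Rightarrow>
     (nat \<Rightarrow> real) \<Rightarrow> (nat \<Rightarrow> real) \<Rightarrow> (nat \<Rightarrow> real) \<Rightarrow> nat \<Rightarrow> nat \<Rightarrow> bool" where
  "closed_loop k\<^sub>1 k\<^sub>2 T\<^sub>c a d r \<alpha> x\<^sub>1 x\<^sub>2 u m n \<longleftrightarrow>
     (\<forall>k\<in>{m<..n}.
        x\<^sub>1 k = x\<^sub>1 (k - 1) + T\<^sub>c * (a * x\<^sub>2 (k - 1) + d) \<and>
        x\<^sub>2 k = x\<^sub>2 (k - 1) + T\<^sub>c * u (k - 1)) \<and>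
     (\<forall>k\<in>{m<..n}.
        u k = k\<^sub>2 * (\<alpha> k * (k\<^sub>1 * tracking_error r x\<^sub>1 k - (x\<^sub>1 k - x\<^sub>1 (k - 1)) / T\<^sub>c)
                    + x\<^sub>2 (k - 1) - x\<^sub>2 k))"

definition loop_state ::
    "real \<Rightarrow> real \<Rightarrow> real \<Rightarrow> (nat \<Rightarrow> real) \<Rightarrow> (nat \<Rightarrow> real) \<Rightarrow> nat \<Rightarrow> real^3" where
  "loop_state a d r x\<^sub>1 x\<^sub>2 k =
     vector [tracking_error r x\<^sub>1 k, a * x\<^sub>2 k + d, a * x\<^sub>2 (k - 1) + d]"

end

theory Submission
  imports Defs
begin

text \<open>
  The quadratic form \<open>V x = x \<bullet> (P *v x)\<close> is a common Lyapunov function. Since \<open>A_d\<close> is affine in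
  \<open>\<rho>\<close> and \<open>V\<close> is convex, the decrease \<open>V (A_d \<rho> x) \<le> V x - x \<bullet> (Q *v x)\<close> extends from the two
  endpoints to all \<open>\<rho>\<close> between them, and compactness of the unit sphere turns it into
  \<open>V (A_d \<rho> x) \<le> c * V x\<close> with one constant \<open>c < 1\<close>.
\<close>

lemma quadratic_form_upper_bound:
  fixes M :: "real^'n^'n"
  obtains b where "b > 0" "\<And>x. x \<bullet> (M *v x) \<le> b * (norm x)\<^sup>2"
proof -
  obtain b where b: "b > 0" "\<And>x. norm (M *v x) \<le> norm x * b"
    using bounded_linear.pos_bounded[OF matrix_vector_mul_bounded_linear[of M]] by blast
  have "x \<bullet> (M *v x) \<le> b * (norm x)\<^sup>2" for x
  proof -
    have "x \<bullet> (M *v x) \<le> norm x * norm (M *v x)"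
      by (rule norm_cauchy_schwarz)
    also have "\<dots> \<le> norm x * (norm x * b)"
      by (intro mult_left_mono b) auto
    finally show ?thesis
      by (simp add: power2_eq_square mult_ac)
  qed
  with b(1) show thesis by (rule that)
qed

text \<open>The constant is the minimum of the form on the unit sphere. It is attained by
  compactness, hence positive, and homogeneity of degree two carries the bound to every
  vector.\<close>

lemma positive_definite_lower_bound:
  fixes M :: "real^'n^'n"
  assumes "positive_definite M"
  obtains b where "b > 0" "\<And>x. b * (norm x)\<^sup>2 \<le> x \<bullet> (M *v x)"
proof -
  have "continuous_on (sphere 0 1) (\<lambda>x::real^'n. x \<bullet> (M *v x))"
    by (intro continuous_intros)
  moreover have "sphere (0 :: real^'n) 1 \<noteq> {}"
    by simp
  ultimately obtain y :: "real^'n" where y: "y \<in> sphere 0 1"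
    and y_min: "\<And>x. x \<in> sphere 0 1 \<Longrightarrow> y \<bullet> (M *v y) \<le> x \<bullet> (M *v x)"
    using continuous_attains_inf[OF compact_sphere] by blast
  show thesis
  proof
    from y have "y \<noteq> 0" by auto
    then show "0 < y \<bullet> (M *v y)"
      using assms by (simp add: positive_definite_def)
    show "y \<bullet> (M *v y) * (norm x)\<^sup>2 \<le> x \<bullet> (M *v x)" for x
    proof (cases "x = 0")
      case False
      define z where "z = x /\<^sub>R norm x"
      have "x = norm x *\<^sub>R z" and "z \<in> sphere 0 1"
        using False by (auto simp: z_def)
      then have "x \<bullet> (M *v x) = (norm x)\<^sup>2 * (z \<bullet> (M *v z))"
        by (metis inner_scaleR_left inner_scaleR_right matrix_vector_mult_scaleR mult.assoc
            power2_eq_square)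
      with mult_left_mono[OF y_min[OF \<open>z \<in> sphere 0 1\<close>], of "(norm x)\<^sup>2"] show ?thesis
        by (simp add: mult.commute)
    qed simp
  qed
qed

text \<open>By bilinearity the gap between the two sides is exactly \<open>t * (1 - t)\<close> times
  the form at \<open>x - y\<close>.\<close>

lemma quadratic_form_convex:
  fixes M :: "real^'n^'n"
  assumes "positive_semidefinite M" "0 \<le> t" "t \<le> 1"
  shows "((1 - t) *\<^sub>R x + t *\<^sub>R y) \<bullet> (M *v ((1 - t) *\<^sub>R x + t *\<^sub>R y))
           \<le> (1 - t) * (x \<bullet> (M *v x)) + t * (y \<bullet> (M *v y))"
proof -
  have "(1 - t) * (x \<bullet> (M *v x)) + t * (y \<bullet> (M *v y))
      - ((1 - t) *\<^sub>R x + t *\<^sub>R y) \<bullet> (M *v ((1 - t) *\<^sub>R x + t *\<^sub>R y))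
      = t * (1 - t) * ((x - y) \<bullet> (M *v (x - y)))"
    by (simp add: matrix_vector_right_distrib matrix_vector_mult_diff_distrib
        matrix_vector_mult_scaleR inner_add_left inner_add_right inner_diff_left
        inner_diff_right) (simp add: algebra_simps)
  moreover have "0 \<le> t * (1 - t) * ((x - y) \<bullet> (M *v (x - y)))"
    using assms by (simp add: positive_semidefinite_def)
  ultimately show ?thesis by linarith
qed

text \<open>This lets a Loewner inequality for \<open>transpose A ** P ** A\<close> be read as a
  bound on the Lyapunov function after one step.\<close>

lemma inner_congruence:
  fixes A P :: "real^'n^'n"
  shows "x \<bullet> ((transpose A ** P ** A) *v x) = (A *v x) \<bullet> (P *v (A *v x))"
  by (metis dot_lmul_matrix matrix_vector_mul_assoc vector_transpose_matrix)

text \<open>The upper bound on \<open>V\<close> makes the loss \<open>q * (norm x)\<^sup>2\<close>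
  at least a fixed fraction of \<open>V x\<close>, so \<open>V\<close> contracts geometrically at a
  rate that depends neither on the time nor on the state.\<close>

lemma lyapunov_uniformly_exponentially_stable:
  fixes f :: "nat \<Rightarrow> 'a::real_normed_vector \<Rightarrow> 'a" and V :: "'a \<Rightarrow> real"
  assumes "0 < p" "0 < q"
    and lower: "\<And>x. p * (norm x)\<^sup>2 \<le> V x"
    and upper: "\<And>x. V x \<le> b * (norm x)\<^sup>2"
    and decrease: "\<And>k x. V (f k x) \<le> V x - q * (norm x)\<^sup>2"
  shows "uniformly_exponentially_stable f"
proof -
  \<comment> \<open>Enlarging \<open>b\<close> keeps the contraction factor \<open>c\<close> strictly positive and makes \<open>b / p \<ge> 1\<close>.\<close>
  define b' where "b' = max b (p + q)"
  define c where "c = 1 - q / b'"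
  have b': "b \<le> b'" "p \<le> b'" "q < b'" "0 < b'"
    using assms(1,2) by (auto simp: b'_def)
  have c: "0 < c" "c < 1"
    using b' assms(2) by (auto simp: c_def)
  have upper': "V x \<le> b' * (norm x)\<^sup>2" for x
    using upper[of x] mult_right_mono[OF b'(1), of "(norm x)\<^sup>2"] by simp
  have contract: "V (f k x) \<le> c * V x" for k x
  proof -
    have "V x / b' \<le> (norm x)\<^sup>2"
      using upper'[of x] b'(4) by (simp add: field_simps)
    then have "q * (V x / b') \<le> q * (norm x)\<^sup>2"
      using assms(2) by (intro mult_left_mono) auto
    with decrease[of k x] show ?thesis
      by (simp add: c_def algebra_simps)
  qed
  have "norm (\<xi> k) \<le> sqrt (b' / p) * sqrt c ^ (k - k\<^sub>0) * norm (\<xi> k\<^sub>0)"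
    if step: "\<forall>k\<ge>k\<^sub>0. \<xi> (Suc k) = f k (\<xi> k)" and "k \<ge> k\<^sub>0" for k\<^sub>0 k \<xi>
  proof -
    have V: "V (\<xi> k) \<le> c ^ (k - k\<^sub>0) * V (\<xi> k\<^sub>0)"
      using \<open>k \<ge> k\<^sub>0\<close>
    proof (induction k rule: dec_induct)
      case (step k)
      have "V (\<xi> (Suc k)) \<le> c * V (\<xi> k)"
        using contract that(1) step.hyps by simp
      also have "\<dots> \<le> c * (c ^ (k - k\<^sub>0) * V (\<xi> k\<^sub>0))"
        using c step.IH by (intro mult_left_mono) auto
      finally show ?case
        using step.hyps by (simp add: Suc_diff_le)
    qed simp
    \<comment> \<open>The two quadratic bounds translate the decay of \<open>V\<close> into decay of
      the squared norm. Taking roots turns the factor \<open>b' / p\<close> and the rate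
      \<open>c\<close> into \<open>sqrt (b' / p)\<close> and \<open>sqrt c\<close>.\<close>
    note lower[of "\<xi> k"]
    also note V
    also have "c ^ (k - k\<^sub>0) * V (\<xi> k\<^sub>0) \<le> c ^ (k - k\<^sub>0) * (b' * (norm (\<xi> k\<^sub>0))\<^sup>2)"
      using c by (intro mult_left_mono upper') auto
    finally have "(norm (\<xi> k))\<^sup>2 \<le> b' / p * c ^ (k - k\<^sub>0) * (norm (\<xi> k\<^sub>0))\<^sup>2"
      using assms(1) by (simp add: field_simps)
    then have "norm (\<xi> k) \<le> sqrt (b' / p * c ^ (k - k\<^sub>0) * (norm (\<xi> k\<^sub>0))\<^sup>2)"
      by (rule real_le_rsqrt)
    then show ?thesis
      by (simp only: real_sqrt_mult real_sqrt_power real_sqrt_abs abs_norm_cancel)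
         (simp add: real_sqrt_power[symmetric])
  qed
  moreover have "1 \<le> sqrt (b' / p)" "0 < sqrt c" "sqrt c < 1"
    using b' c assms(1) by auto
  ultimately show ?thesis
    unfolding uniformly_exponentially_stable_def by blast
qed

lemma A_d_mult_vec:
  "A_d k\<^sub>1 k\<^sub>2 T\<^sub>c \<rho> *v x = vector
     [x $ 1 - T\<^sub>c * x $ 2,
      T\<^sub>c * k\<^sub>1 * k\<^sub>2 * \<rho> * x $ 1 + (1 - T\<^sub>c * k\<^sub>2) * x $ 2 + T\<^sub>c * k\<^sub>2 * (1 - \<rho>) * x $ 3,
      x $ 2]"
  by (simp add: vec_eq_iff forall_3 A_d_def matrix_vector_mult_def sum_3 vector_3)

text \<open>The parameter enters only two entries of the second row, each to first order. This is
  what makes checking the two endpoints sufficient.\<close>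

lemma A_d_affine:
  "A_d k\<^sub>1 k\<^sub>2 T\<^sub>c ((1 - t) * \<rho> + t * \<sigma>) *v x
     = (1 - t) *\<^sub>R (A_d k\<^sub>1 k\<^sub>2 T\<^sub>c \<rho> *v x) + t *\<^sub>R (A_d k\<^sub>1 k\<^sub>2 T\<^sub>c \<sigma> *v x)"
  by (simp add: A_d_mult_vec vec_eq_iff forall_3 vector_3 algebra_simps)

text \<open>The difference quotient of \<open>x\<^sub>1\<close> at \<open>k\<close> is the previous
  \<open>w\<close>, and \<open>a * (x\<^sub>2 (k - 1) - x\<^sub>2 k)\<close> is a difference of two
  values of \<open>w\<close> because \<open>d\<close> cancels. So \<open>a * u k\<close> is linear
  in the state, with \<open>a * \<alpha> k\<close> as the parameter.\<close>

lemma loop_state_Suc: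
  assumes "T\<^sub>c \<noteq> 0" "closed_loop k\<^sub>1 k\<^sub>2 T\<^sub>c a d r \<alpha> x\<^sub>1 x\<^sub>2 u m n" "m < k" "k < n"
  shows "loop_state a d r x\<^sub>1 x\<^sub>2 (Suc k) =
    A_d k\<^sub>1 k\<^sub>2 T\<^sub>c (a * \<alpha> k) *v loop_state a d r x\<^sub>1 x\<^sub>2 k"
proof -
  \<comment> \<open>Both instants matter: the laws at \<open>k\<close> give the control and the
    difference quotient, the plant at \<open>Suc k\<close> gives the update.\<close>
  have "k \<in> {m<..n}" "Suc k \<in> {m<..n}"
    using assms by auto
  then have x1: "x\<^sub>1 (Suc k) = x\<^sub>1 k + T\<^sub>c * (a * x\<^sub>2 k + d)"
    and x2: "x\<^sub>2 (Suc k) = x\<^sub>2 k + T\<^sub>c * u k"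
    and x1': "x\<^sub>1 k = x\<^sub>1 (k - 1) + T\<^sub>c * (a * x\<^sub>2 (k - 1) + d)"
    and u: "u k = k\<^sub>2 * (\<alpha> k * (k\<^sub>1 * tracking_error r x\<^sub>1 k - (x\<^sub>1 k - x\<^sub>1 (k - 1)) / T\<^sub>c)
                    + x\<^sub>2 (k - 1) - x\<^sub>2 k)"
    using assms(2) unfolding closed_loop_def by fastforce+
  have "(x\<^sub>1 k - x\<^sub>1 (k - 1)) / T\<^sub>c = a * x\<^sub>2 (k - 1) + d"
    using x1' assms(1) by (simp add: field_simps)
  then have u': "u k = k\<^sub>2 * (\<alpha> k * (k\<^sub>1 * (r - x\<^sub>1 k) - (a * x\<^sub>2 (k - 1) + d))
                    + x\<^sub>2 (k - 1) - x\<^sub>2 k)"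
    using u by (simp add: tracking_error_def)
  show ?thesis
    unfolding A_d_mult_vec loop_state_def
    by (simp add: vec_eq_iff forall_3 vector_3 tracking_error_def x1 x2 u' algebra_simps)
qed

lemma A_d_decrease:
  assumes P: "positive_semidefinite P"
    and decr: "\<forall>\<rho>\<in>{\<rho>\<^sub>L, \<rho>\<^sub>U}.
           transpose (A_d k\<^sub>1 k\<^sub>2 T\<^sub>c \<rho>) ** P ** A_d k\<^sub>1 k\<^sub>2 T\<^sub>c \<rho> - P \<preceq> - Q"
    and \<rho>: "\<rho> \<in> {\<rho>\<^sub>L..\<rho>\<^sub>U}"
  shows "(A_d k\<^sub>1 k\<^sub>2 T\<^sub>c \<rho> *v x) \<bullet> (P *v (A_d k\<^sub>1 k\<^sub>2 T\<^sub>c \<rho> *v x))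
           \<le> x \<bullet> (P *v x) - x \<bullet> (Q *v x)"
proof -
  let ?V = "\<lambda>\<sigma>. (A_d k\<^sub>1 k\<^sub>2 T\<^sub>c \<sigma> *v x) \<bullet> (P *v (A_d k\<^sub>1 k\<^sub>2 T\<^sub>c \<sigma> *v x))"
  let ?D = "x \<bullet> (P *v x) - x \<bullet> (Q *v x)"
  have endpoint: "?V \<sigma> \<le> ?D" if "\<sigma> \<in> {\<rho>\<^sub>L, \<rho>\<^sub>U}" for \<sigma>
  proof -
    have "0 \<le> x \<bullet> ((- Q - (transpose (A_d k\<^sub>1 k\<^sub>2 T\<^sub>c \<sigma>) ** P ** A_d k\<^sub>1 k\<^sub>2 T\<^sub>c \<sigma> - P)) *v x)"
      using decr that unfolding loewner_le_def positive_semidefinite_def by blast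
    also have "- Q - (transpose (A_d k\<^sub>1 k\<^sub>2 T\<^sub>c \<sigma>) ** P ** A_d k\<^sub>1 k\<^sub>2 T\<^sub>c \<sigma> - P)
        = P - Q - transpose (A_d k\<^sub>1 k\<^sub>2 T\<^sub>c \<sigma>) ** P ** A_d k\<^sub>1 k\<^sub>2 T\<^sub>c \<sigma>"
      by simp
    finally show ?thesis
      by (simp only: matrix_vector_mult_diff_rdistrib inner_diff_right inner_congruence)
  qed
  \<comment> \<open>Going through the segment yields the weight \<open>t\<close> without dividing by
    \<open>\<rho>\<^sub>U - \<rho>\<^sub>L\<close>, which may be zero.\<close>
  have "\<rho> \<in> closed_segment \<rho>\<^sub>L \<rho>\<^sub>U"
    using \<rho> by (auto simp: closed_segment_eq_real_ivl)
  then obtain t where t: "0 \<le> t" "t \<le> 1" and \<rho>_eq: "\<rho> = (1 - t) * \<rho>\<^sub>L + t * \<rho>\<^sub>U"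
    by (auto simp: closed_segment_def)
  have "?V \<rho> \<le> (1 - t) * ?V \<rho>\<^sub>L + t * ?V \<rho>\<^sub>U"
    unfolding \<rho>_eq A_d_affine by (rule quadratic_form_convex[OF P t])
  also have "\<dots> \<le> (1 - t) * ?D + t * ?D"
    using t by (intro add_mono mult_left_mono endpoint) auto
  finally show ?thesis
    by (simp add: algebra_simps)
qed

theorem theorem1:
  fixes k\<^sub>1 k\<^sub>2 T\<^sub>c \<rho>\<^sub>L \<rho>\<^sub>U :: real and P Q :: "real^3^3"
  assumes "k\<^sub>1 > 0" and "k\<^sub>2 > 0" and "T\<^sub>c > 0" and "\<rho>\<^sub>L \<le> \<rho>\<^sub>U"
    and "0 \<prec> P" and "0 \<prec> Q"
    and "\<forall>\<rho>\<in>{\<rho>\<^sub>L, \<rho>\<^sub>U}.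
           transpose (A_d k\<^sub>1 k\<^sub>2 T\<^sub>c \<rho>) ** P ** A_d k\<^sub>1 k\<^sub>2 T\<^sub>c \<rho> - P \<preceq> - Q"
  shows "(\<forall>a d r \<alpha> x\<^sub>1 x\<^sub>2 u m n.
            a > 0 \<longrightarrow> closed_loop k\<^sub>1 k\<^sub>2 T\<^sub>c a d r \<alpha> x\<^sub>1 x\<^sub>2 u m n \<longrightarrow>
            (\<forall>k\<in>{m<..<n}. loop_state a d r x\<^sub>1 x\<^sub>2 (Suc k) =
               A_d k\<^sub>1 k\<^sub>2 T\<^sub>c (a * \<alpha> k) *v loop_state a d r x\<^sub>1 x\<^sub>2 k)) \<and>
         (\<forall>\<rho> :: nat \<Rightarrow> real. (\<forall>k. \<rho> k \<in> {\<rho>\<^sub>L..\<rho>\<^sub>U}) \<longrightarrow>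
            uniformly_exponentially_stable (\<lambda>k \<xi>. A_d k\<^sub>1 k\<^sub>2 T\<^sub>c (\<rho> k) *v \<xi>))"
proof (intro conjI allI impI ballI)
  show "loop_state a d r x\<^sub>1 x\<^sub>2 (Suc k) =
      A_d k\<^sub>1 k\<^sub>2 T\<^sub>c (a * \<alpha> k) *v loop_state a d r x\<^sub>1 x\<^sub>2 k"
    if "closed_loop k\<^sub>1 k\<^sub>2 T\<^sub>c a d r \<alpha> x\<^sub>1 x\<^sub>2 u m n" "k \<in> {m<..<n}"
    for a d r \<alpha> x\<^sub>1 x\<^sub>2 u m n k
    using loop_state_Suc[OF _ that(1)] that(2) assms(3) by simp
next
  fix \<rho> :: "nat \<Rightarrow> real"
  assume \<rho>: "\<forall>k. \<rho> k \<in> {\<rho>\<^sub>L..\<rho>\<^sub>U}"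
  have P: "positive_definite P" and Q: "positive_definite Q"
    using assms(5,6) by (simp_all add: loewner_less_def)
  \<comment> \<open>The constants \<open>p\<close>, \<open>q\<close> and \<open>b\<close> come from
    \<open>P\<close> and \<open>Q\<close> alone, so the resulting decay estimate is the same for all
    admissible parameter sequences.\<close>
  obtain p where p: "p > 0" "\<And>x. p * (norm x)\<^sup>2 \<le> x \<bullet> (P *v x)"
    using positive_definite_lower_bound[OF P] by blast
  obtain q where q: "q > 0" "\<And>x. q * (norm x)\<^sup>2 \<le> x \<bullet> (Q *v x)"
    using positive_definite_lower_bound[OF Q] by blast
  obtain b where b: "\<And>x. x \<bullet> (P *v x) \<le> b * (norm x)\<^sup>2"
    using quadratic_form_upper_bound[of P] by blast
  have P': "positive_semidefinite P"
    using P unfolding positive_definite_def positive_semidefinite_def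
    by (metis inner_zero_left less_imp_le order_refl)
  show "uniformly_exponentially_stable (\<lambda>k \<xi>. A_d k\<^sub>1 k\<^sub>2 T\<^sub>c (\<rho> k) *v \<xi>)"
  proof (rule lyapunov_uniformly_exponentially_stable[OF p(1) q(1) p(2) b])
    fix k x
    show "(A_d k\<^sub>1 k\<^sub>2 T\<^sub>c (\<rho> k) *v x) \<bullet> (P *v (A_d k\<^sub>1 k\<^sub>2 T\<^sub>c (\<rho> k) *v x))
        \<le> x \<bullet> (P *v x) - q * (norm x)\<^sup>2"
      using A_d_decrease[OF P' assms(7), of "\<rho> k" x] \<rho> q(2)[of x] by simp
  qed
qed

end
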